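(* For closed, non-preemptive online Dial-a-Ride on the line, the competitive ratio of $\textsc{Smartstart}_\Theta$ with $\Theta=2$ is exactly $2$. For every other $\Theta>1$ with $\Theta\neq 2$, the competitive ratio of $\textsc{Smartstart}_\Theta$ is larger than $2$.
   Context: Closed, non-preemptive Dial-a-Ride on the real line. An instance is a finite nonempty set of requests $\sigma=\{\sigma_1,\dots,\sigma_n\}$ with $\sigma_i=(a_i,b_i;r_i)$, $a_i,b_i\in\mathbb{R}$, $r_i\ge 0$: request $\sigma_i$ appears at time $r_i$ at position $a_i$ and must be transported to position $b_i$. A single server of capacity $c\in\mathbb{N}\cup\{\infty\}$ (arbitrary but fixed) starts at the origin at time $0$, moves with unit speed (it may also wait), cannot pick up a request before its release time, never carries more than $c$ requests at once, and a request that was picked up stays on board until it is delivered at its destination (non-preemptive). In the closed version every schedule must end with the server at the origin. The length of a schedule is the time from its start until all its requests are delivered and the server has returned to the origin (waiting included). $L(t,p,R)$ is the length of a shortest such schedule that starts at position $p$ at time $t$, serves all requests in $R\subseteq\sigma$ respecting release times, and ends at the origin. The offline optimum is $\textsc{Opt}(\sigma):=L(0,0,\sigma)$. In the online problem, $\sigma_i$ is revealed only at time $r_i$, and the number of requests is not known in advance. Algorithm $\textsc{Smartstart}_\Theta$ (parameter $\Theta>1$) for the closed version: let $R_t$ be the set of requests with release time at most $t$ that have not been served by time $t$. Whenever the server is idle (necessarily at the origin) at current time $t$, it waits until there are unserved released requests and then until the earliest time $\min\{t'\ge t: R_{t'}\ne\emptyset,\ t'\ge L(t',0,R_{t'})/(\Theta-1)\}$.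 At that time $t'$ it starts a shortest closed schedule serving $R_{t'}$ from the origin and returning to the origin, and executes it while ignoring all newly appearing requests; then it repeats. $\textsc{Smartstart}(\sigma)$ denotes the time at which all requests of $\sigma$ have been served and the server is back at the origin. The competitive ratio of $\textsc{Smartstart}_\Theta$ is the infimum of all $\rho$ with $\textsc{Smartstart}(\sigma)\le\rho\,\textsc{Opt}(\sigma)$ for all instances $\sigma$. *)

theory Defs
  imports Complex_Main "HOL-Library.Extended_Nat" "HOL-Library.Extended_Real"
begin

datatype request = Request (src: real) (dst: real) (release: real)

definition is_instance :: "request set \<Rightarrow> bool" where
  "is_instance \<sigma> \<longleftrightarrow> finite \<sigma> \<and> \<sigma> \<noteq> {} \<and> (\<forall>q\<in>\<sigma>. 0 \<le> release q)"

text \<open>A server configuration \<open>(t, p, W, B)\<close> consists of the current time, the current position,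
  the requests still to be picked up, and the requests on board.  Pickups and deliveries are
  instantaneous; a request leaves \<open>B\<close> only at its destination and never returns to \<open>W\<close>, which is
  non-preemptiveness.  A request with equal source and destination also occupies a place in the
  server between its pickup and its delivery.\<close>

type_synonym config = "real \<times> real \<times> request set \<times> request set"

inductive server_step :: "enat \<Rightarrow> config \<Rightarrow> config \<Rightarrow> bool" for c :: enat where
  wait: "0 \<le> d \<Longrightarrow> server_step c (t, p, W, B) (t + d, p, W, B)"
| move: "server_step c (t, p, W, B) (t + \<bar>x - p\<bar>, x, W, B)"
| pickup: "\<lbrakk>q \<in> W; src q = p; release q \<le> t; enat (card (insert q B)) \<le> c\<rbrakk>
    \<Longrightarrow> server_step c (t, p, W, B) (t, p, W - {q}, insert q B)"
| deliver: "\<lbrakk>q \<in> B; dst q = p\<rbrakk>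
    \<Longrightarrow> server_step c (t, p, W, B) (t, p, W, B - {q})"

text \<open>\<open>closed_schedule c t p R T\<close>: some schedule starts at time \<open>t\<close> in position \<open>p\<close>, serves
  exactly the requests in \<open>R\<close>, and ends at time \<open>T\<close> in the origin.\<close>

definition closed_schedule :: "enat \<Rightarrow> real \<Rightarrow> real \<Rightarrow> request set \<Rightarrow> real \<Rightarrow> bool" where
  "closed_schedule c t p R T \<longleftrightarrow> (server_step c)\<^sup>*\<^sup>* (t, p, R, {}) (T, 0, {}, {})"

text \<open>For finite \<open>R\<close> and \<open>c > 0\<close> the set of lengths is nonempty, and the infimum is a minimum.\<close>

definition L :: "enat \<Rightarrow> real \<Rightarrow> real \<Rightarrow> request set \<Rightarrow> real" where
  "L c t p R = Inf {T - t | T. closed_schedule c t p R T}"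

definition Opt :: "enat \<Rightarrow> request set \<Rightarrow> real" where
  "Opt c \<sigma> = L c 0 0 \<sigma>"

text \<open>\<open>S\<close> is the set of requests served so far; when the server is idle, these are the requests
  of all schedules executed before.\<close>

definition unserved :: "request set \<Rightarrow> request set \<Rightarrow> real \<Rightarrow> request set" where
  "unserved \<sigma> S t = {q \<in> \<sigma>. release q \<le> t} - S"

definition may_start :: "enat \<Rightarrow> real \<Rightarrow> request set \<Rightarrow> request set \<Rightarrow> real \<Rightarrow> bool" where
  "may_start c \<Theta> \<sigma> S t \<longleftrightarrow>
     unserved \<sigma> S t \<noteq> {} \<and> L c t 0 (unserved \<sigma> S t) / (\<Theta> - 1) \<le> t"

text \<open>The states \<open>(t, S)\<close> are those in which the server is idle (in the origin) at time \<open>t\<close>.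
  One step consists of waiting until the starting time \<open>t'\<close> and then executing a shortest
  schedule, which ends at time \<open>T\<close>.\<close>

inductive smartstart_step ::
  "enat \<Rightarrow> real \<Rightarrow> request set \<Rightarrow> real \<times> request set \<Rightarrow> real \<times> request set \<Rightarrow> bool"
  for c :: enat and \<Theta> :: real and \<sigma> :: "request set" where
  "\<lbrakk>t \<le> t'; may_start c \<Theta> \<sigma> S t'; \<forall>u. t \<le> u \<and> u < t' \<longrightarrow> \<not> may_start c \<Theta> \<sigma> S u;
    R = unserved \<sigma> S t'; closed_schedule c t' 0 R T; T - t' = L c t' 0 R\<rbrakk>
    \<Longrightarrow> smartstart_step c \<Theta> \<sigma> (t, S) (T, S \<union> R)"

text \<open>The choice among several shortest schedules does not influence their common ending time in
  the origin, so the completion time is unique.\<close>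

definition Smartstart :: "enat \<Rightarrow> real \<Rightarrow> request set \<Rightarrow> real" where
  "Smartstart c \<Theta> \<sigma> = (THE T. (smartstart_step c \<Theta> \<sigma>)\<^sup>*\<^sup>* (0, {}) (T, \<sigma>))"

text \<open>The infimum is taken in the extended reals, so the ratio is \<open>\<infinity>\<close> if no \<open>\<rho>\<close> is admissible.\<close>

definition competitive_ratio :: "enat \<Rightarrow> real \<Rightarrow> ereal" where
  "competitive_ratio c \<Theta> =
     Inf {ereal \<rho> | \<rho>. \<forall>\<sigma>. is_instance \<sigma> \<longrightarrow> Smartstart c \<Theta> \<sigma> \<le> \<rho> * Opt c \<sigma>}"

end

theory Submission
  imports Defs
begin

text \<open>Let \<open>\<Theta> = 2\<close>, let \<open>R\<close> be the set of requests served by the last schedule, \<open>l\<close> its length, and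
  \<open>u\<close> the starting time of the schedule before (\<open>u = 0\<close> if there is none).  The server is idle again
  by time \<open>2 u\<close>, and all requests in \<open>R\<close> are released after \<open>u\<close>.  If the last schedule is delayed
  beyond that point, it starts by the time \<open>max l r \<le> Opt\<close>, where \<open>r\<close> is the last release time,
  and \<open>l \<le> Opt\<close>.  Otherwise let \<open>a\<close> be the position where the optimum picks up its first request of
  \<open>R\<close>, at time \<open>s \<ge> u\<close>.  From there it needs time at least \<open>\<bar>a\<bar>\<close> to return, and going to \<open>a\<close> and then
  following it serves \<open>R\<close>, so \<open>\<bar>a\<bar> \<le> Opt - s\<close> and \<open>l \<le> \<bar>a\<bar> + Opt - s\<close>, whence \<open>2 u + l \<le> 2 Opt\<close>.

  For \<open>\<Theta> \<le> 2\<close> the single point request in \<open>1/2\<close> released at time \<open>0\<close> has ratio \<open>\<Theta> / (\<Theta> - 1)\<close>.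
  For \<open>\<Theta> > 2\<close> a second request in the same point, released slightly after the start of the server at
  time \<open>1 / (\<Theta> - 1)\<close>, gives a ratio above \<open>2\<close>.\<close>

section \<open>Schedules\<close>

abbreviation server_run :: "enat \<Rightarrow> config \<Rightarrow> config \<Rightarrow> bool" where
  "server_run c \<equiv> (server_step c)\<^sup>*\<^sup>*"

lemma server_run_speed:
  "server_run c (t, p, W, B) (T, x, W', B') \<Longrightarrow> t + \<bar>x - p\<bar> \<le> T"
proof (induction "(t, p, W, B)" arbitrary: t p W B rule: converse_rtranclp_induct)
  case base
  then show ?case by simp
next
  case (step y)
  from step.hyps(1) show ?case
    by cases (use step.hyps(3) in fastforce)+
qed

text \<open>By the triangle inequality, all waits and moves before the first pickup or delivery cost
  at least the direct trip to it. This exposes the first event for recursion and for cutting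
  schedules.\<close>

lemma server_run_first_event:
  "server_run c (t, p, W, B) (T, 0, {}, {}) \<Longrightarrow>
    (W = {} \<and> B = {} \<and> t + \<bar>p\<bar> \<le> T) \<or>
    (\<exists>q\<in>W. \<exists>s. t + \<bar>src q - p\<bar> \<le> s \<and> release q \<le> s \<and> enat (card (insert q B)) \<le> c \<and>
      server_run c (s, src q, W - {q}, insert q B) (T, 0, {}, {})) \<or>
    (\<exists>q\<in>B. \<exists>s. t + \<bar>dst q - p\<bar> \<le> s \<and> server_run c (s, dst q, W, B - {q}) (T, 0, {}, {}))"
proof (induction "(t, p, W, B)" arbitrary: t p W B rule: converse_rtranclp_induct)
  case base
  then show ?case by simp
next
  case (step y)
  from step.hyps(1) show ?case
  proof cases
    case (wait d)
    have le: "t + a \<le> s" if "t + d + a \<le> s" for a s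
      using that wait(2) by simp
    show ?thesis
      using step.hyps(3)[OF wait(1)] le by blast
  next
    case (move x)
    have le: "t + \<bar>a - p\<bar> \<le> s" if "t + \<bar>x - p\<bar> + \<bar>a - x\<bar> \<le> s" for a s
      using that by linarith
    have le0: "t + \<bar>p\<bar> \<le> s" if "t + \<bar>x - p\<bar> + \<bar>x\<bar> \<le> s" for s
      using that by linarith
    show ?thesis
      using step.hyps(3)[OF move] le le0 by blast
  next
    case (pickup q)
    then show ?thesis
      using step.hyps(2) by (intro disjI2 disjI1 bexI[of _ q] exI[of _ t]) auto
  next
    case (deliver q)
    then show ?thesis
      using step.hyps(2) by (intro disjI2 bexI[of _ q] exI[of _ t]) auto
  qed
qed

text \<open>Leaving out requests only lowers the load, and a delay respects release times. A step
  that concerns an omitted request vanishes, hence a run in the conclusion. Finiteness of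
  \<open>B\<close> makes \<open>card\<close> monotone.\<close>

lemma server_step_restrict_shift:
  assumes "server_step c (t, p, W, B) (t', p', W', B')" "finite B" "0 \<le> s"
  shows "server_run c (t + s, p, W \<inter> R, B \<inter> R) (t' + s, p', W' \<inter> R, B' \<inter> R)"
  using assms(1)
proof cases
  case (wait d)
  then show ?thesis
    using server_step.wait[of d c "t + s" p "W \<inter> R" "B \<inter> R"] by (auto simp: algebra_simps)
next
  case move
  then show ?thesis
    using server_step.move[of c "t + s" p "W \<inter> R" "B \<inter> R" p'] by (auto simp: algebra_simps)
next
  case (pickup q)
  show ?thesis
  proof (cases "q \<in> R")
    case True
    have "card (insert q (B \<inter> R)) \<le> card (insert q B)"
      using assms(2) by (intro card_mono) auto
    then have "enat (card (insert q (B \<inter> R))) \<le> c"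
      using pickup(8) by (meson enat_ord_simps(1) order_trans)
    then have "server_step c (t + s, p, W \<inter> R, B \<inter> R)
        (t + s, p, W \<inter> R - {q}, insert q (B \<inter> R))"
      using pickup True assms(3) by (intro server_step.pickup) auto
    moreover have "W \<inter> R - {q} = W' \<inter> R" "insert q (B \<inter> R) = B' \<inter> R"
      using pickup True by auto
    ultimately show ?thesis
      using pickup by auto
  next
    case False
    then have "W' \<inter> R = W \<inter> R" "B' \<inter> R = B \<inter> R"
      using pickup by auto
    then show ?thesis
      using pickup by simp
  qed
next
  case (deliver q)
  show ?thesis
  proof (cases "q \<in> R")
    case True
    then have "server_step c (t + s, p, W \<inter> R, B \<inter> R) (t + s, p, W \<inter> R, B \<inter> R - {q})"
      using deliver by (intro server_step.deliver) auto
    moreover have "B \<inter> R - {q} = B' \<inter> R"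
      using deliver by auto
    ultimately show ?thesis
      using deliver by auto
  next
    case False
    then have "B' \<inter> R = B \<inter> R"
      using deliver by auto
    then show ?thesis
      using deliver by simp
  qed
qed

lemma server_run_restrict_shift:
  assumes "server_run c (t, p, W, B) (T, x, W', B')" "finite B" "0 \<le> s"
  shows "server_run c (t + s, p, W \<inter> R, B \<inter> R) (T + s, x, W' \<inter> R, B' \<inter> R)"
  using assms(1,2)
proof (induction "(t, p, W, B)" arbitrary: t p W B rule: converse_rtranclp_induct)
  case base
  then show ?case by simp
next
  case (step y)
  obtain t1 p1 W1 B1 where y: "y = (t1, p1, W1, B1)"
    by (cases y)
  have "finite B1"
    using step.hyps(1) step.prems unfolding y by cases auto
  then show ?case
    using server_step_restrict_shift[OF step.hyps(1)[unfolded y] step.prems assms(3), of R]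
      step.hyps(3)[OF y] by (meson rtranclp_trans)
qed

lemma closed_schedule_restrict_shift:
  assumes "closed_schedule c t p W T" "R \<subseteq> W" "0 \<le> s"
  shows "closed_schedule c (t + s) p R (T + s)"
  using server_run_restrict_shift[of c t p W "{}" T 0 "{}" "{}" s R] assms
  unfolding closed_schedule_def by (simp add: Int_absorb1)

lemma closed_schedule_restrict:
  assumes "closed_schedule c t p W T" "R \<subseteq> W"
  shows "closed_schedule c t p R T"
  using closed_schedule_restrict_shift[OF assms, of 0] by simp

section \<open>Assembling schedules from their first action\<close>

lemma closed_schedule_move:
  assumes "closed_schedule c (t + \<bar>x - p\<bar>) x R T"
  shows "closed_schedule c t p R T"
  using assms server_step.move[of c t p R "{}" x] unfolding closed_schedule_def
  by (meson converse_rtranclp_into_rtranclp)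

lemma closed_schedule_wait:
  assumes "closed_schedule c s p R T" "t \<le> s"
  shows "closed_schedule c t p R T"
  using assms server_step.wait[of "s - t" c t p R "{}"] unfolding closed_schedule_def
  by (simp add: converse_rtranclp_into_rtranclp)

lemma closed_schedule_serve_point:
  assumes "closed_schedule c t p (R - {q}) T" "q \<in> R" "src q = p" "dst q = p" "release q \<le> t" "0 < c"
  shows "closed_schedule c t p R T"
proof -
  have "enat (card (insert q {})) \<le> c"
    using assms(6) by (cases c) (auto simp: zero_enat_def)
  then have "server_step c (t, p, R, {}) (t, p, R - {q}, {q})"
    using assms by (intro server_step.pickup) auto
  moreover have "server_step c (t, p, R - {q}, {q}) (t, p, R - {q}, {})"
    using assms server_step.deliver[of q "{q}" p c t "R - {q}"] by simp
  ultimately show ?thesis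
    using assms(1) unfolding closed_schedule_def by (meson converse_rtranclp_into_rtranclp)
qed

lemma closed_schedule_return: "closed_schedule c t p {} (t + \<bar>p\<bar>)"
  using server_step.move[of c t p "{}" "{}" 0] unfolding closed_schedule_def by auto

text \<open>Cuts a schedule at its first pickup: until then nothing is served, so the remainder from
  \<open>src q\<close> still serves all of \<open>R\<close>, and it must also get home from
  there.\<close>

lemma closed_schedule_first_pickup:
  assumes "closed_schedule c t p R T" "R \<noteq> {}"
  obtains q s where "q \<in> R" "t + \<bar>src q - p\<bar> \<le> s" "release q \<le> s" "s + \<bar>src q\<bar> \<le> T"
    "closed_schedule c s (src q) R T"
proof -
  obtain q s where q: "q \<in> R" "t + \<bar>src q - p\<bar> \<le> s" "release q \<le> s" "enat (card {q}) \<le> c"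
    and run: "server_run c (s, src q, R - {q}, {q}) (T, 0, {}, {})"
    using server_run_first_event[of c t p R "{}" T] assms unfolding closed_schedule_def by auto
  have "server_step c (s, src q, R, {}) (s, src q, R - {q}, {q})"
    using q by (intro server_step.pickup) auto
  with run have "closed_schedule c s (src q) R T"
    unfolding closed_schedule_def by (rule converse_rtranclp_into_rtranclp[rotated])
  then show ?thesis
    using q server_run_speed[OF run] that by auto
qed

section \<open>Shortest schedules\<close>

text \<open>The first event of a schedule is one of finitely many pickups and deliveries, and each of them
  decreases \<open>2 * card W + card B\<close>; so the minimum exists by induction.  Waiting is useless once all
  requests are released, and hence the minimum does not depend on the starting time.\<close>

lemma shortest_run_exists:
  assumes "0 < c" "finite W" "finite B"
  shows "\<exists>m. \<forall>t. (\<forall>q\<in>W. release q \<le> t) \<longrightarrow>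
    server_run c (t, p, W, B) (t + m, 0, {}, {}) \<and>
    (\<forall>T. server_run c (t, p, W, B) (T, 0, {}, {}) \<longrightarrow> t + m \<le> T)"
  using assms(2,3)
proof (induction "2 * card W + card B" arbitrary: p W B rule: less_induct)
  case less
  define good where "good p W B m \<longleftrightarrow> (\<forall>t. (\<forall>q\<in>W. release q \<le> t) \<longrightarrow>
    server_run c (t, p, W, B) (t + m, 0, {}, {}) \<and>
    (\<forall>T. server_run c (t, p, W, B) (T, 0, {}, {}) \<longrightarrow> t + m \<le> T))" for p W B m
  show ?case
  proof (cases "W = {} \<and> B = {}")
    case True
    then show ?thesis
      using closed_schedule_return[of c _ p] server_run_speed[of c _ p "{}" "{}" _ 0 "{}" "{}"]
      unfolding closed_schedule_def by (intro exI[of _ "\<bar>p\<bar>"]) auto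
  next
    case False
    \<comment> \<open>The pickups that the capacity permits as first event.\<close>
    define P where "P = {q \<in> W. enat (card (insert q B)) \<le> c}"
    have "\<exists>m. good (src q) (W - {q}) (insert q B) m" if "q \<in> W" for q
    proof -
      have "card (W - {q}) < card W"
        using that less.prems by (intro psubset_card_mono) auto
      moreover have "card (insert q B) \<le> Suc (card B)"
        by (rule card_insert_le_m1) auto
      ultimately have "2 * card (W - {q}) + card (insert q B) < 2 * card W + card B"
        by linarith
      then show ?thesis
        using less.hyps[of "W - {q}" "insert q B" "src q"] less.prems unfolding good_def by simp
    qed
    then obtain f where f: "\<And>q. q \<in> W \<Longrightarrow> good (src q) (W - {q}) (insert q B) (f q)"
      by metis
    have "\<exists>m. good (dst q) W (B - {q}) m" if "q \<in> B" for q
    proof -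
      have "card (B - {q}) < card B"
        using that less.prems by (intro psubset_card_mono) auto
      then show ?thesis
        using less.hyps[of W "B - {q}" "dst q"] less.prems unfolding good_def by simp
    qed
    then obtain g where g: "\<And>q. q \<in> B \<Longrightarrow> good (dst q) W (B - {q}) (g q)"
      by metis
    define V where "V = (\<lambda>q. \<bar>src q - p\<bar> + f q) ` P \<union> (\<lambda>q. \<bar>dst q - p\<bar> + g q) ` B"
    have fin: "finite V"
      unfolding V_def P_def using less.prems by auto
    \<comment> \<open>Some first event is always possible: a delivery if the server is loaded,
      otherwise a pickup, since the capacity is at least one.\<close>
    have "P \<noteq> {}" if "B = {}"
    proof -
      have "enat (Suc 0) \<le> c"
        using assms(1) by (cases c) (auto simp: zero_enat_def)
      then show ?thesis
        using that False unfolding P_def by auto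
    qed
    then have ne: "V \<noteq> {}"
      unfolding V_def by auto
    have "good p W B (Min V)"
      unfolding good_def
    proof (intro allI impI conjI)
      fix t assume t: "\<forall>q\<in>W. release q \<le> t"
      have later: "\<forall>q\<in>W. release q \<le> s" if "t \<le> s" for s
        using t that by force
      have move: "server_run c (t, p, W, B) (t + \<bar>x - p\<bar>, x, W, B)" for x
        by (intro r_into_rtranclp server_step.move)
      from Min_in[OF fin ne] consider
          q where "q \<in> P" "Min V = \<bar>src q - p\<bar> + f q"
        | q where "q \<in> B" "Min V = \<bar>dst q - p\<bar> + g q"
        unfolding V_def by auto
      then show "server_run c (t, p, W, B) (t + Min V, 0, {}, {})"
      proof cases
        case 1
        let ?s = "t + \<bar>src q - p\<bar>"
        have "server_step c (?s, src q, W, B) (?s, src q, W - {q}, insert q B)"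
          using 1 later[of ?s] unfolding P_def by (intro server_step.pickup) auto
        moreover have "server_run c (?s, src q, W - {q}, insert q B) (?s + f q, 0, {}, {})"
          using f[of q] 1 later[of ?s] unfolding good_def P_def by auto
        ultimately have "server_run c (?s, src q, W, B) (t + Min V, 0, {}, {})"
          using 1(2) by (simp add: add.assoc converse_rtranclp_into_rtranclp)
        with move show ?thesis
          by (rule rtranclp_trans)
      next
        case 2
        let ?s = "t + \<bar>dst q - p\<bar>"
        have "server_step c (?s, dst q, W, B) (?s, dst q, W, B - {q})"
          using 2 by (intro server_step.deliver) auto
        moreover have "server_run c (?s, dst q, W, B - {q}) (?s + g q, 0, {}, {})"
          using g[of q] 2 later[of ?s] unfolding good_def by auto
        ultimately have "server_run c (?s, dst q, W, B) (t + Min V, 0, {}, {})"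
          using 2(2) by (simp add: add.assoc converse_rtranclp_into_rtranclp)
        with move show ?thesis
          by (rule rtranclp_trans)
      qed
      fix T assume "server_run c (t, p, W, B) (T, 0, {}, {})"
      from server_run_first_event[OF this] False consider
          q s where "q \<in> P" "t + \<bar>src q - p\<bar> \<le> s"
            "server_run c (s, src q, W - {q}, insert q B) (T, 0, {}, {})"
        | q s where "q \<in> B" "t + \<bar>dst q - p\<bar> \<le> s"
            "server_run c (s, dst q, W, B - {q}) (T, 0, {}, {})"
        unfolding P_def by auto
      then show "t + Min V \<le> T"
      proof cases
        case 1
        have "s + f q \<le> T"
          using f[of q] 1 later[of s] unfolding good_def P_def by auto
        moreover have "Min V \<le> \<bar>src q - p\<bar> + f q"
          using fin 1 unfolding V_def by (intro Min_le) auto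
        ultimately show ?thesis
          using 1 by linarith
      next
        case 2
        have "s + g q \<le> T"
          using g[of q] 2 later[of s] unfolding good_def by auto
        moreover have "Min V \<le> \<bar>dst q - p\<bar> + g q"
          using fin 2 unfolding V_def by (intro Min_le) auto
        ultimately show ?thesis
          using 2 by linarith
      qed
    qed
    then show ?thesis
      unfolding good_def by blast
  qed
qed

section \<open>Transfer from schedules to \<open>L\<close>\<close>

lemma L_le:
  assumes "closed_schedule c t p R T"
  shows "L c t p R \<le> T - t"
  unfolding L_def
proof (rule cInf_lower)
  show "bdd_below {T - t | T. closed_schedule c t p R T}"
    \<comment> \<open>Every schedule must at least travel home from \<open>p\<close>.\<close>
    by (rule bdd_belowI[of _ "\<bar>p\<bar>"])
      (auto simp: closed_schedule_def dest: server_run_speed)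
qed (use assms in blast)

lemma shortest_schedule_exists:
  assumes "0 < c" "finite R"
  obtains m where "\<And>t. \<forall>q\<in>R. release q \<le> t \<Longrightarrow> L c t p R = m"
    "\<And>t. \<forall>q\<in>R. release q \<le> t \<Longrightarrow> closed_schedule c t p R (t + m)"
proof -
  obtain m where m: "\<And>t. \<forall>q\<in>R. release q \<le> t \<Longrightarrow> closed_schedule c t p R (t + m)"
    "\<And>t T. \<lbrakk>\<forall>q\<in>R. release q \<le> t; closed_schedule c t p R T\<rbrakk> \<Longrightarrow> t + m \<le> T"
    using shortest_run_exists[OF assms, of "{}" p] unfolding closed_schedule_def by auto
  have "L c t p R = m" if t: "\<forall>q\<in>R. release q \<le> t" for t
  proof (rule antisym)
    show "L c t p R \<le> m"
      using L_le[OF m(1)[OF t]] by simp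
    show "m \<le> L c t p R"
      unfolding L_def using m(1)[OF t] m(2)[OF t] by (intro cInf_greatest) (force)+
  qed
  then show ?thesis
    using m(1) that by blast
qed

text \<open>Waiting for the last release reduces this to the case of released requests. It keeps the
  infimum in \<open>L\<close> over a nonempty set for every \<open>t\<close>.\<close>

lemma closed_schedule_exists:
  assumes "0 < c" "finite R"
  shows "\<exists>T. closed_schedule c t p R T"
proof -
  obtain s where s: "\<forall>q\<in>R. release q \<le> s" "t \<le> s"
    using bdd_above_finite[OF finite_insert[THEN iffD2, OF finite_imageI[OF assms(2)]], of t release]
    unfolding bdd_above_def by auto
  obtain m where "closed_schedule c s p R (s + m)"
    using shortest_schedule_exists[OF assms] s(1) by metis
  then show ?thesis
    using closed_schedule_wait s(2) by blast
qed

lemma L_greatest: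
  assumes "0 < c" "finite R" "\<And>T. closed_schedule c t p R T \<Longrightarrow> x \<le> T - t"
  shows "x \<le> L c t p R"
  unfolding L_def using closed_schedule_exists[OF assms(1,2)] assms(3)
  by (intro cInf_greatest) auto

lemma L_nonneg:
  assumes "0 < c" "finite R"
  shows "0 \<le> L c t p R"
proof (rule L_greatest[OF assms])
  fix T assume "closed_schedule c t p R T"
  then show "0 \<le> T - t"
    unfolding closed_schedule_def by (auto dest!: server_run_speed)
qed

lemma L_shift:
  assumes "0 < c" "finite R" "\<forall>q\<in>R. release q \<le> t" "\<forall>q\<in>R. release q \<le> u"
  shows "L c t p R = L c u p R"
  using assms(3,4) by (metis shortest_schedule_exists[OF assms(1,2)])

lemma closed_schedule_L:
  assumes "0 < c" "finite R" "\<forall>q\<in>R. release q \<le> t"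
  shows "closed_schedule c t p R (t + L c t p R)"
  using assms(3) by (metis shortest_schedule_exists[OF assms(1,2)])

lemma L_ge_source:
  assumes "0 < c" "finite R" "q \<in> R"
  shows "2 * \<bar>src q\<bar> \<le> L c t 0 R"
proof (rule L_greatest[OF assms(1,2)])
  fix T assume "closed_schedule c t 0 R T"
  then have "closed_schedule c t 0 {q} T"
    using closed_schedule_restrict assms(3) by blast
  then show "2 * \<bar>src q\<bar> \<le> T - t"
    by (rule closed_schedule_first_pickup) auto
qed

text \<open>Going to \<open>x\<close> and then copying the given schedule, restricted to
  \<open>R\<close>, serves \<open>R\<close>.\<close>

lemma L_le_schedule:
  assumes "0 < c" "finite R" "R \<subseteq> W" "closed_schedule c s x W T" "\<forall>q\<in>R. release q \<le> t"
  shows "L c t p R \<le> \<bar>x - p\<bar> + (T - s)"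
proof -
  \<comment> \<open>Starting at \<open>u \<ge> s\<close> makes the copy a delayed one;
    \<open>L_shift\<close> then carries the length back to \<open>t\<close>, so the wait is not
    charged.\<close>
  define u where "u = max s t"
  have u: "\<forall>q\<in>R. release q \<le> u"
    using assms(5) unfolding u_def by force
  have "closed_schedule c (s + (u + \<bar>x - p\<bar> - s)) x R (T + (u + \<bar>x - p\<bar> - s))"
    using assms(3,4) unfolding u_def by (intro closed_schedule_restrict_shift) auto
  then have "closed_schedule c u p R (T + (u + \<bar>x - p\<bar> - s))"
    by (intro closed_schedule_move[of c u x]) simp
  from L_le[OF this] show ?thesis
    using L_shift[OF assms(1,2,5) u] by (simp add: algebra_simps)
qed

text \<open>The first pickup from \<open>R\<close> happens at some \<open>s \<ge> u\<close>. Both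
  the distance of its source from the origin and the remaining schedule are at most
  \<open>T - s\<close>, so \<open>L\<close> is at most \<open>2 * (T - s)\<close>.\<close>

lemma L_late_requests:
  assumes "0 < c" "finite R" "R \<noteq> {}" "R \<subseteq> W" "closed_schedule c 0 0 W T"
    and "\<forall>q\<in>R. u \<le> release q" "\<forall>q\<in>R. release q \<le> t"
  shows "2 * u + L c t 0 R \<le> 2 * T"
proof -
  obtain q s where q: "q \<in> R" "release q \<le> s" "s + \<bar>src q\<bar> \<le> T" "closed_schedule c s (src q) R T"
    using closed_schedule_restrict[OF assms(5,4)] assms(3)
    by (rule closed_schedule_first_pickup)
  have "L c t 0 R \<le> \<bar>src q - 0\<bar> + (T - s)"
    using assms q by (intro L_le_schedule) auto
  moreover have "u \<le> s"
    using assms(6) q(1,2) by force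
  ultimately show ?thesis
    using q(3) by simp
qed

lemma closed_schedule_ge_release:
  assumes "0 < c" "closed_schedule c 0 0 W T" "q \<in> W"
  shows "release q \<le> T"
  \<comment> \<open>For the singleton with \<open>u = release q\<close> the estimate reads
    \<open>2 * release q + L \<le> 2 * T\<close>, with \<open>L\<close> nonnegative.\<close>
  using L_late_requests[OF assms(1) _ _ _ assms(2), of "{q}" "release q" "release q"]
    L_nonneg[OF assms(1), of "{q}" "release q" 0] assms(3) by simp

section \<open>Runs of Smartstart\<close>

abbreviation smartstart_run ::
  "enat \<Rightarrow> real \<Rightarrow> request set \<Rightarrow> real \<times> request set \<Rightarrow> real \<times> request set \<Rightarrow> bool" where
  "smartstart_run c \<Theta> \<sigma> \<equiv> (smartstart_step c \<Theta> \<sigma>)\<^sup>*\<^sup>*"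

lemma unserved_subset: "unserved \<sigma> S t \<subseteq> \<sigma>"
  unfolding unserved_def by auto

lemma finite_unserved: "finite \<sigma> \<Longrightarrow> finite (unserved \<sigma> S t)"
  using finite_subset[OF unserved_subset] .

text \<open>The unserved set takes finitely many values, and each yields one candidate for the
  earliest start; so the infimum of admissible times is attained.\<close>

lemma earliest_start_exists:
  assumes "0 < c" "finite \<sigma>" "\<not> \<sigma> \<subseteq> S"
  obtains t' where "t \<le> t'" "may_start c \<Theta> \<sigma> S t'"
    "\<forall>u. t \<le> u \<and> u < t' \<longrightarrow> \<not> may_start c \<Theta> \<sigma> S u"
proof -
  define r where "r U = Max (release ` U)" for U
  \<comment> \<open>The first time from \<open>t\<close> on at which \<open>U\<close> is fully
    released and long enough awaited.\<close>
  define g where "g U = Max {t, r U, L c (r U) 0 U / (\<Theta> - 1)}" for U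
  define A where "A = {u. t \<le> u \<and> may_start c \<Theta> \<sigma> S u}"
  have rel: "\<forall>q\<in>U. release q \<le> u" if "U \<subseteq> \<sigma>" "r U \<le> u" for U u
  proof
    fix q assume "q \<in> U"
    then have "release q \<le> r U"
      unfolding r_def using finite_subset[OF that(1) assms(2)] by (intro Max_ge) auto
    then show "release q \<le> u"
      using that(2) by simp
  qed
  have L_eq: "L c u 0 U = L c (r U) 0 U" if "U \<subseteq> \<sigma>" "r U \<le> u" for U u
    using L_shift[OF assms(1) finite_subset[OF that(1) assms(2)]] rel[OF that(1)] that(2) by simp
  have may: "g U \<in> A" if "U \<subseteq> \<sigma>" "U \<noteq> {}" "unserved \<sigma> S (g U) = U" for U
    using that L_eq[of U "g U"] unfolding A_def may_start_def g_def by auto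
  \<comment> \<open>Every admissible time is bounded below by an admissible candidate: between
    \<open>g ?U\<close> and \<open>u\<close> the unserved set does not change.\<close>
  have below: "g (unserved \<sigma> S u) \<in> A \<and> g (unserved \<sigma> S u) \<le> u" if "u \<in> A" for u
  proof -
    let ?U = "unserved \<sigma> S u"
    have ne: "?U \<noteq> {}"
      using that unfolding A_def may_start_def by simp
    have r_le: "r ?U \<le> u"
      unfolding r_def using ne finite_unserved[OF assms(2)]
      by (subst Max_le_iff) (auto simp: unserved_def)
    then have le: "g ?U \<le> u"
      using that L_eq[OF unserved_subset r_le] r_le unfolding A_def may_start_def g_def by auto
    moreover have "r ?U \<le> g ?U"
      unfolding g_def by simp
    then have "unserved \<sigma> S (g ?U) = ?U"
      using le rel[OF unserved_subset, of S u "g ?U"] unfolding unserved_def by auto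
    ultimately show ?thesis
      using may[OF unserved_subset ne] by simp
  qed
  \<comment> \<open>After the last release the unserved set is all of \<open>\<sigma> - S\<close>,
    so at least one candidate is admissible.\<close>
  have "r (\<sigma> - S) \<le> g (\<sigma> - S)"
    unfolding g_def by simp
  from rel[OF _ this] have "g (\<sigma> - S) \<in> A"
    using assms(3) by (intro may) (auto simp: unserved_def)
  moreover define G where "G = g ` Pow \<sigma> \<inter> A"
  ultimately have "g (\<sigma> - S) \<in> G"
    by auto
  then have "G \<noteq> {}" by auto
  moreover have "finite G"
    unfolding G_def using assms(2) by auto
  ultimately have "Min G \<in> G"
    by (rule Min_in[rotated])
  then have "Min G \<in> A"
    by (simp add: G_def)
  moreover have "Min G \<le> u" if "u \<in> A" for u
  proof -
    have "g (unserved \<sigma> S u) \<in> G"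
      using below[OF that] unserved_subset unfolding G_def by blast
    then show ?thesis
      using below[OF that] \<open>finite G\<close> by (meson Min_le order_trans)
  qed
  ultimately show ?thesis
    using that unfolding A_def by force
qed

lemma smartstart_step_exists:
  assumes "0 < c" "finite \<sigma>" "\<not> \<sigma> \<subseteq> S"
  obtains T R where "smartstart_step c \<Theta> \<sigma> (t, S) (T, S \<union> R)" "R \<subseteq> \<sigma>" "\<not> R \<subseteq> S"
proof -
  obtain t' where t': "t \<le> t'" "may_start c \<Theta> \<sigma> S t'"
    "\<forall>u. t \<le> u \<and> u < t' \<longrightarrow> \<not> may_start c \<Theta> \<sigma> S u"
    using earliest_start_exists[OF assms] .
  let ?R = "unserved \<sigma> S t'"
  have "closed_schedule c t' 0 ?R (t' + L c t' 0 ?R)"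
    using assms by (intro closed_schedule_L finite_unserved) (auto simp: unserved_def)
  from smartstart_step.intros[OF t' refl this]
  have "smartstart_step c \<Theta> \<sigma> (t, S) (t' + L c t' 0 ?R, S \<union> ?R)"
    by simp
  moreover have "\<not> ?R \<subseteq> S"
    using t'(2) unfolding may_start_def unserved_def by auto
  ultimately show ?thesis
    using that[of _ ?R] unserved_subset by blast
qed

lemma smartstart_run_exists:
  assumes "0 < c" "finite \<sigma>" "S \<subseteq> \<sigma>"
  shows "\<exists>T. smartstart_run c \<Theta> \<sigma> (t, S) (T, \<sigma>)"
  using assms(3)
proof (induction "card (\<sigma> - S)" arbitrary: t S rule: less_induct)
  case less
  show ?case
  proof (cases "S = \<sigma>")
    case False
    then obtain T R where R: "smartstart_step c \<Theta> \<sigma> (t, S) (T, S \<union> R)" "R \<subseteq> \<sigma>" "\<not> R \<subseteq> S"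
      using smartstart_step_exists[OF assms(1,2)] less.prems by (metis subset_antisym)
    have "card (\<sigma> - (S \<union> R)) < card (\<sigma> - S)"
      using R assms(2) by (intro psubset_card_mono) auto
    then show ?thesis
      using less.hyps[of "S \<union> R" T] less.prems R by (auto intro: converse_rtranclp_into_rtranclp)
  qed auto
qed

section \<open>Uniqueness of the completion time\<close>

lemma smartstart_step_deterministic:
  assumes "smartstart_step c \<Theta> \<sigma> x y" "smartstart_step c \<Theta> \<sigma> x z"
  shows "y = z"
  using assms(1)
proof cases
  case fst: (1 t t1 S R1 T1)
  from assms(2) show ?thesis
  proof cases
    case snd: (1 t' t2 S' R2 T2)
    have "t' = t" "S' = S"
      using fst(1) snd(1) by auto
    then have "t1 = t2"
      using fst(3-5) snd(3-5) by (meson antisym not_le)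
    then have "R1 = R2"
      using fst(6) snd(6) \<open>S' = S\<close> by simp
    moreover from this have "T1 = T2"
      using fst(8) snd(8) \<open>t1 = t2\<close> by simp
    ultimately show ?thesis
      using fst(2) snd(2) \<open>S' = S\<close> by simp
  qed
qed

lemma smartstart_step_complete: "\<not> smartstart_step c \<Theta> \<sigma> (T, \<sigma>) y"
  by (auto simp: may_start_def unserved_def elim!: smartstart_step.cases)

text \<open>Steps are deterministic and states with everything served are terminal, so neither run
  can branch off or continue.\<close>

lemma smartstart_run_unique:
  assumes "smartstart_run c \<Theta> \<sigma> x (T, \<sigma>)" "smartstart_run c \<Theta> \<sigma> x (T', \<sigma>)"
  shows "T = T'"
  using assms
proof (induction rule: converse_rtranclp_induct)
  case base
  then show ?case
    by (cases rule: converse_rtranclpE) (auto simp: smartstart_step_complete)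
next
  case (step y z)
  from step.prems show ?case
  proof (cases rule: converse_rtranclpE)
    case base
    then show ?thesis
      using step.hyps(1) smartstart_step_complete by blast
  next
    case (step w)
    then show ?thesis
      using step.IH smartstart_step_deterministic \<open>smartstart_step c \<Theta> \<sigma> y z\<close> by blast
  qed
qed

lemma smartstart_run_Smartstart:
  assumes "0 < c" "finite \<sigma>"
  shows "smartstart_run c \<Theta> \<sigma> (0, {}) (Smartstart c \<Theta> \<sigma>, \<sigma>)"
  unfolding Smartstart_def
  by (rule theI') (use smartstart_run_exists[OF assms, of "{}"] smartstart_run_unique in blast)

lemma smartstart_run_mono:
  assumes "0 < c" "finite \<sigma>" "smartstart_run c \<Theta> \<sigma> x y"
  shows "fst x \<le> fst y"
  using assms(3)
proof induction
  case (step y z)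
  from step.hyps(2) have "fst y \<le> fst z"
  proof cases
    case (1 t t' S R T)
    then show ?thesis
      using L_nonneg[OF assms(1) finite_unserved[OF assms(2)], of t' 0 S t'] by simp
  qed
  with step.IH show ?case by simp
qed simp

section \<open>The upper bound\<close>

text \<open>Take for \<open>u\<close> the start of the latest schedule. For
  \<open>\<Theta> = 2\<close> the starting rule bounds its length by \<open>u\<close>, and requests
  not in it or served before were unreleased at \<open>u\<close>. Before any schedule,
  \<open>u = 0\<close> works.\<close>

lemma smartstart_run_idle_time:
  assumes "is_instance \<sigma>" "smartstart_run c 2 \<sigma> (0, {}) (t, S)"
  shows "\<exists>u. t \<le> 2 * u \<and> (\<forall>q\<in>\<sigma> - S. u \<le> release q)"
  using assms(2)
proof (cases rule: rtranclp.cases)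
  case rtrancl_refl
  then show ?thesis
    using assms(1) by (intro exI[of _ 0]) (auto simp: is_instance_def)
next
  case (rtrancl_into_rtrancl y)
  from rtrancl_into_rtrancl(2) show ?thesis
  proof cases
    case (1 t0 t' S' R)
    then show ?thesis
      by (intro exI[of _ t']) (auto simp: may_start_def unserved_def)
  qed
qed

lemma Smartstart_le_two_Opt:
  assumes "0 < c" "is_instance \<sigma>"
  shows "Smartstart c 2 \<sigma> \<le> 2 * Opt c \<sigma>"
proof -
  have fin: "finite \<sigma>" and ne: "\<sigma> \<noteq> {}"
    using assms(2) unfolding is_instance_def by auto
  let ?T = "Smartstart c 2 \<sigma>"
  from smartstart_run_Smartstart[OF assms(1) fin]
  obtain t S where run: "smartstart_run c 2 \<sigma> (0, {}) (t, S)"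
    and last: "smartstart_step c 2 \<sigma> (t, S) (?T, \<sigma>)"
    using ne by (cases rule: rtranclp.cases) auto
  from last obtain t' where t': "t \<le> t'" "may_start c 2 \<sigma> S t'"
    "\<forall>u. t \<le> u \<and> u < t' \<longrightarrow> \<not> may_start c 2 \<sigma> S u"
    and S: "\<sigma> = S \<union> unserved \<sigma> S t'" and T: "?T - t' = L c t' 0 (unserved \<sigma> S t')"
  proof cases
    case (1 t' R)
    show ?thesis
      using that[OF 1(2-4)] 1(1,5,7) by metis
  qed
  define R where "R = unserved \<sigma> S t'"
  define l where "l = L c t' 0 R"
  have R: "R \<subseteq> \<sigma>" "R \<noteq> {}" "finite R" "R = \<sigma> - S"
    using t'(2) S fin finite_unserved unserved_subset unfolding R_def may_start_def
    by (auto simp: unserved_def)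
  have rel: "\<forall>q\<in>R. release q \<le> t'"
    unfolding R_def unserved_def by auto
  obtain u where u: "t \<le> 2 * u" "\<forall>q\<in>R. u \<le> release q"
    using smartstart_run_idle_time[OF assms(2) run] R by auto
  define r where "r = Max (release ` R)"
  have r: "\<forall>q\<in>R. release q \<le> r"
    unfolding r_def using R by auto
  have "r \<in> release ` R"
    unfolding r_def using R by (intro Max_in) auto
  then obtain z where z: "z \<in> R" "r = release z"
    by auto
  \<comment> \<open>At time \<open>s\<close> the starting rule already holds for \<open>R\<close>,
    whence \<open>t' \<le> s\<close>.\<close>
  define s where "s = Max {t, r, l}"
  have "\<forall>q\<in>R. release q \<le> s"
    using r unfolding s_def by force
  moreover from this have "unserved \<sigma> S s = R"
    using R(4) unfolding unserved_def by auto
  ultimately have "may_start c 2 \<sigma> S s"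
    using R L_shift[OF assms(1) R(3) rel, of s 0] unfolding may_start_def s_def l_def by simp
  moreover have "t \<le> s"
    unfolding s_def by simp
  ultimately have "t' \<le> s"
    using t'(3) not_le by blast
  \<comment> \<open>It suffices to compare with an arbitrary closed schedule, ending at
    \<open>T\<close>.\<close>
  have "?T / 2 \<le> L c 0 0 \<sigma>"
  proof (rule L_greatest[OF assms(1) fin])
    fix T assume opt: "closed_schedule c 0 0 \<sigma> T"
    have "l \<le> T"
      using L_le_schedule[OF assms(1) R(3,1) opt rel, of 0] unfolding l_def by simp
    moreover have "r \<le> T"
      using closed_schedule_ge_release[OF assms(1) opt] z R(1) by blast
    moreover have "2 * u + l \<le> 2 * T"
      unfolding l_def using L_late_requests[OF assms(1) R(3,2,1) opt u(2) rel] .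
    moreover have "?T = t' + l"
      using T unfolding l_def R_def by simp
    \<comment> \<open>If \<open>s = t\<close>, then \<open>t' + l \<le> 2 * u + l\<close>; if
      \<open>s\<close> is \<open>r\<close> or \<open>l\<close>, then \<open>t'\<close> and
      \<open>l\<close> are each at most \<open>T\<close>.\<close>
    ultimately show "?T / 2 \<le> T - 0"
      using \<open>t' \<le> s\<close> u(1) unfolding s_def by auto
  qed
  then show ?thesis
    unfolding Opt_def by simp
qed

section \<open>The lower bounds\<close>

lemma competitive_ratio_ge:
  assumes "0 < c" "is_instance \<sigma>" "Opt c \<sigma> \<le> b" "a \<le> Smartstart c \<Theta> \<sigma>" "0 < a" "0 < b"
  shows "ereal (a / b) \<le> competitive_ratio c \<Theta>"
  unfolding competitive_ratio_def
proof (rule Inf_greatest)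
  fix x assume "x \<in> {ereal \<rho> | \<rho>. \<forall>\<sigma>. is_instance \<sigma> \<longrightarrow> Smartstart c \<Theta> \<sigma> \<le> \<rho> * Opt c \<sigma>}"
  then obtain \<rho> where \<rho>: "x = ereal \<rho>" "Smartstart c \<Theta> \<sigma> \<le> \<rho> * Opt c \<sigma>"
    using assms(2) by auto
  have nonneg: "0 \<le> Opt c \<sigma>"
    unfolding Opt_def using assms(1,2) by (intro L_nonneg) (auto simp: is_instance_def)
  have le: "a \<le> \<rho> * Opt c \<sigma>"
    using assms(4) \<rho>(2) by simp
  \<comment> \<open>The sign of \<open>\<rho>\<close> is not given. It must be positive before
    \<open>Opt\<close> may be replaced by its upper bound \<open>b\<close>.\<close>
  then have "0 < \<rho> * Opt c \<sigma>"
    using assms(5) by simp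
  then have "0 < \<rho>"
    using nonneg by (auto simp: zero_less_mult_iff)
  then have "\<rho> * Opt c \<sigma> \<le> \<rho> * b"
    using assms(3) by simp
  then show "ereal (a / b) \<le> x"
    using le assms(6) \<rho>(1) by (simp add: divide_le_eq)
qed

text \<open>The position 1/2 normalizes the round trip to length 1, so that the first start is at
  \<open>1 / (\<Theta> - 1)\<close>.\<close>

definition half_request :: "real \<Rightarrow> request" where
  "half_request r = Request (1/2) (1/2) r"

lemma half_request_sel [simp]:
  "src (half_request r) = 1/2" "dst (half_request r) = 1/2" "release (half_request r) = r"
  by (simp_all add: half_request_def)

lemma L_half_request:
  assumes "0 < c" "r \<le> t"
  shows "L c t 0 {half_request r} = 1"
proof (rule antisym)
  have "closed_schedule c (t + 1/2) (1/2) {half_request r} (t + 1/2 + \<bar>1/2\<bar>)"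
    by (rule closed_schedule_serve_point[where q = "half_request r"])
      (use assms closed_schedule_return[of c "t + 1/2" "1/2"] in auto)
  then have "closed_schedule c t 0 {half_request r} (t + 1)"
    by (intro closed_schedule_move[of c t "1/2"]) (simp add: add.commute)
  from L_le[OF this] show "L c t 0 {half_request r} \<le> 1"
    by simp
  show "1 \<le> L c t 0 {half_request r}"
    using L_ge_source[OF assms(1), of "{half_request r}" "half_request r" t] by simp
qed

text \<open>The server waits at 1/2 for the second request and serves both there. For
  \<open>r = 0\<close> the requests coincide, which covers the one-request instance.\<close>

lemma Opt_half_requests_le:
  assumes "0 < c"
  shows "Opt c {half_request 0, half_request r} \<le> max 1 (r + 1/2)"
proof -
  let ?\<sigma> = "{half_request 0, half_request r}" and ?s = "max (1/2) r"
  have *: "closed_schedule c ?s (1/2) {} (?s + 1/2)"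
    using closed_schedule_return[of c ?s "1/2"] by simp
  have "closed_schedule c ?s (1/2) (?\<sigma> - {half_request 0}) (?s + 1/2)"
  proof (cases "?\<sigma> - {half_request 0} = {}")
    case False
    show ?thesis
      by (rule closed_schedule_serve_point[where q = "half_request r"]) (use * False assms in auto)
  qed (use * in simp)
  then have "closed_schedule c ?s (1/2) ?\<sigma> (?s + 1/2)"
    by (rule closed_schedule_serve_point[where q = "half_request 0"]) (use assms in auto)
  then have "closed_schedule c (1/2) (1/2) ?\<sigma> (?s + 1/2)"
    by (rule closed_schedule_wait) simp
  then have "closed_schedule c 0 0 ?\<sigma> (?s + 1/2)"
    by (intro closed_schedule_move[of c 0 "1/2"]) simp
  from L_le[OF this] show ?thesis
    unfolding Opt_def by simp
qed

text \<open>The condition on \<open>r\<close> says that the second request is either the first one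
  itself or appears strictly after the start, so that the first schedule misses it.\<close>

lemma Smartstart_half_request_first_step:
  assumes "0 < c" "1 < \<Theta>" "r = 0 \<or> 1 / (\<Theta> - 1) < r"
    and "smartstart_step c \<Theta> {half_request 0, half_request r} (0, {}) (T, S)"
  shows "S = {half_request 0}" "\<Theta> / (\<Theta> - 1) \<le> T"
proof -
  let ?\<sigma> = "{half_request 0, half_request r}"
  have pos: "0 < 1 / (\<Theta> - 1)"
    using assms(2) by simp
  have un: "unserved ?\<sigma> {} u = {half_request 0}" if "0 \<le> u" "u \<le> 1 / (\<Theta> - 1)" for u
    using that assms(3) unfolding unserved_def by auto
  have may: "may_start c \<Theta> ?\<sigma> {} (1 / (\<Theta> - 1))"
    using un[of "1 / (\<Theta> - 1)"] pos L_half_request[OF assms(1), of 0 "1 / (\<Theta> - 1)"]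
    unfolding may_start_def by simp
  from assms(4) have "S = {half_request 0} \<and> \<Theta> / (\<Theta> - 1) \<le> T"
  proof cases
    case (1 t' R)
    have le: "t' \<le> 1 / (\<Theta> - 1)"
      using 1(4) may pos by (meson less_imp_le not_le)
    then have R: "R = {half_request 0}"
      using un[OF 1(2)] 1(5) by simp
    have l: "L c t' 0 R = 1"
      unfolding R using L_half_request[OF assms(1) 1(2)] .
    then have "1 / (\<Theta> - 1) \<le> t'"
      using 1(3,5) unfolding may_start_def by simp
    then have "1 / (\<Theta> - 1) + 1 \<le> T"
      using 1(7) l by linarith
    moreover have "1 / (\<Theta> - 1) + 1 = \<Theta> / (\<Theta> - 1)"
      using assms(2) by (simp add: field_simps)
    ultimately show ?thesis
      using 1(1) R by simp
  qed
  then show "S = {half_request 0}" "\<Theta> / (\<Theta> - 1) \<le> T"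
    by auto
qed

lemma Smartstart_half_request_ge:
  assumes "0 < c" "1 < \<Theta>"
  shows "\<Theta> / (\<Theta> - 1) \<le> Smartstart c \<Theta> {half_request 0}"
proof -
  let ?\<sigma> = "{half_request 0}"
  from smartstart_run_Smartstart[OF assms(1), of ?\<sigma> \<Theta>]
  obtain T S where first: "smartstart_step c \<Theta> ?\<sigma> (0, {}) (T, S)"
    and rest: "smartstart_run c \<Theta> ?\<sigma> (T, S) (Smartstart c \<Theta> ?\<sigma>, ?\<sigma>)"
    by (cases rule: converse_rtranclpE) auto
  have "\<Theta> / (\<Theta> - 1) \<le> T"
    using Smartstart_half_request_first_step(2)[OF assms, of 0 T S] first by simp
  also have "T \<le> Smartstart c \<Theta> ?\<sigma>"
    using smartstart_run_mono[OF assms(1) _ rest] by simp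
  finally show ?thesis .
qed

lemma Smartstart_two_half_requests_ge:
  assumes "0 < c" "1 < \<Theta>" "1 / (\<Theta> - 1) < r"
  shows "\<Theta> / (\<Theta> - 1) + 1 \<le> Smartstart c \<Theta> {half_request 0, half_request r}"
proof -
  let ?\<sigma> = "{half_request 0, half_request r}"
  have "0 < 1 / (\<Theta> - 1)"
    using assms(2) by simp
  then have "0 < r"
    using assms(3) by (rule less_trans)
  \<comment> \<open>Distinctness forces a second schedule, which costs another round trip of length
    1.\<close>
  then have neq: "half_request 0 \<noteq> half_request r"
    by (simp add: half_request_def)
  from smartstart_run_Smartstart[OF assms(1), of ?\<sigma> \<Theta>]
  obtain T S where first: "smartstart_step c \<Theta> ?\<sigma> (0, {}) (T, S)"
    and rest: "smartstart_run c \<Theta> ?\<sigma> (T, S) (Smartstart c \<Theta> ?\<sigma>, ?\<sigma>)"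
    by (cases rule: converse_rtranclpE) auto
  have S: "S = {half_request 0}" and T: "\<Theta> / (\<Theta> - 1) \<le> T"
    using Smartstart_half_request_first_step[OF assms(1,2) _ first] assms(3) by auto
  from rest obtain T2 S2 where snd: "smartstart_step c \<Theta> ?\<sigma> (T, S) (T2, S2)"
    and rest2: "smartstart_run c \<Theta> ?\<sigma> (T2, S2) (Smartstart c \<Theta> ?\<sigma>, ?\<sigma>)"
    using S neq by (cases rule: converse_rtranclpE) auto
  from snd have "T + 1 \<le> T2"
  proof cases
    case (1 t' R)
    have "R = {half_request r}"
      using 1(3,5) S unfolding may_start_def unserved_def by auto
    then have "1 \<le> L c t' 0 R"
      using L_ge_source[OF assms(1), of R "half_request r" t'] by simp
    then show ?thesis
      using 1(2,7) by linarith
  qed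
  moreover have "T2 \<le> Smartstart c \<Theta> ?\<sigma>"
    using smartstart_run_mono[OF assms(1) _ rest2] by simp
  ultimately show ?thesis
    using T by simp
qed

lemma competitive_ratio_ge_single:
  assumes "0 < c" "1 < \<Theta>"
  shows "ereal (\<Theta> / (\<Theta> - 1)) \<le> competitive_ratio c \<Theta>"
  using competitive_ratio_ge[of c "{half_request 0}" 1 "\<Theta> / (\<Theta> - 1)" \<Theta>] assms
    Opt_half_requests_le[OF assms(1), of 0] Smartstart_half_request_ge[OF assms]
  by (simp add: is_instance_def)

theorem theorem5p1:
  fixes c :: enat
  assumes "0 < c"
  shows "competitive_ratio c 2 = 2 \<and>
    (\<forall>\<Theta>::real. 1 < \<Theta> \<and> \<Theta> \<noteq> 2 \<longrightarrow> 2 < competitive_ratio c \<Theta>)"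
proof (intro conjI allI impI)
  show "competitive_ratio c 2 = 2"
  proof (rule antisym)
    show "competitive_ratio c 2 \<le> 2"
      unfolding competitive_ratio_def using Smartstart_le_two_Opt[OF assms]
      by (intro Inf_lower) (auto intro!: exI[of _ 2])
    show "2 \<le> competitive_ratio c 2"
      using competitive_ratio_ge_single[OF assms, of 2] by simp
  qed
next
  fix \<Theta> :: real
  assume \<Theta>: "1 < \<Theta> \<and> \<Theta> \<noteq> 2"
  show "2 < competitive_ratio c \<Theta>"
  proof (cases "\<Theta> < 2")
    case True
    then have "2 < \<Theta> / (\<Theta> - 1)"
      using \<Theta> by (simp add: field_simps)
    then have "2 < ereal (\<Theta> / (\<Theta> - 1))"
      by simp
    then show ?thesis
      using competitive_ratio_ge_single[OF assms, of \<Theta>] \<Theta> by (meson less_le_trans)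
  next
    case False
    then have "2 < \<Theta>"
      using \<Theta> by simp
    \<comment> \<open>Room for \<open>r\<close>, using \<open>\<Theta> > 2\<close>: above the lower
      end the request misses the first schedule, below the upper end the optimum stays under half
      the algorithm's time.\<close>
    then have "1 / (\<Theta> - 1) < \<Theta> / (\<Theta> - 1) / 2"
      using divide_strict_right_mono[of 1 "\<Theta> / 2" "\<Theta> - 1"] by (simp add: mult.commute)
    then obtain r where r: "1 / (\<Theta> - 1) < r" "r < \<Theta> / (\<Theta> - 1) / 2"
      using dense by blast
    have pos: "0 < 1 / (\<Theta> - 1)" "1 < \<Theta> / (\<Theta> - 1)"
      using \<open>2 < \<Theta>\<close> by (simp_all add: field_simps)
    define b where "b = max 1 (r + 1/2)"
    \<comment> \<open>With \<open>k = \<Theta> / (\<Theta> - 1)\<close>, the two hypotheses handle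
      the two arguments of the maximum \<open>b\<close>.\<close>
    have "2 * b < k + 1" if "r < k / 2" "1 < k" for k
      using that unfolding b_def by (auto simp: max_def)
    from this[OF r(2) pos(2)] have "2 * b < \<Theta> / (\<Theta> - 1) + 1" .
    then have "2 < (\<Theta> / (\<Theta> - 1) + 1) / b"
      unfolding b_def by (simp add: less_divide_eq)
    then have "2 < ereal ((\<Theta> / (\<Theta> - 1) + 1) / b)"
      by simp
    also have "\<dots> \<le> competitive_ratio c \<Theta>"
    proof (rule competitive_ratio_ge[OF assms])
      show "is_instance {half_request 0, half_request r}"
        using less_trans[OF pos(1) r(1)] by (simp add: is_instance_def)
      show "Opt c {half_request 0, half_request r} \<le> b"
        unfolding b_def using Opt_half_requests_le[OF assms] .
      show "\<Theta> / (\<Theta> - 1) + 1 \<le> Smartstart c \<Theta> {half_request 0, half_request r}"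
        using Smartstart_two_half_requests_ge[OF assms _ r(1)] \<Theta> by simp
      show "0 < \<Theta> / (\<Theta> - 1) + 1"
        using pos(2) by linarith
    qed (simp add: b_def)
    finally show ?thesis .
  qed
qed

end
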